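(* Let $I \subseteq \mathbb{R}$ be an interval and let $f : I \to \mathbb{R}$ be uniformly Lipschitz differentiable with derivative $f'$. Then $f'$ is Lipschitz on $I$, i.e. there is a constant $L$, independent of $x$ and $a$, such that $|f'(x) - f'(a)| \leqslant L|x-a|$ for all $x, a \in I$.
   Context: A function $f : I \to \mathbb{R}$ on an interval $I \subseteq \mathbb{R}$ is called uniformly Lipschitz differentiable (ULD) with derivative $f' : I \to \mathbb{R}$ if there is a constant $K$, independent of $x$ and $a$, such that $|f(x) - f(a) - f'(a)(x-a)| \leqslant K (x-a)^2$ for all $x, a \in I$. *)

theory Defs
  imports "HOL-Analysis.Analysis"
begin

text \<open>Functions on \<open>I\<close> are total functions whose values outside \<open>I\<close> are irrelevant. The derivative
  \<open>f'\<close> is part of the data; it is not required to be the derivative in the sense of limits.\<close>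

definition ULD_on :: "real set \<Rightarrow> (real \<Rightarrow> real) \<Rightarrow> (real \<Rightarrow> real) \<Rightarrow> bool" where
  "ULD_on I f f' \<longleftrightarrow>
     (\<exists>K::real. \<forall>x\<in>I. \<forall>a\<in>I. \<bar>f x - f a - f' a * (x - a)\<bar> \<le> K * (x - a)\<^sup>2)"

end

theory Submission
  imports Defs
begin

text \<open>Adding the first-order expansion of \<open>f\<close> around \<open>a\<close>, evaluated at \<open>x\<close>, to the expansion around
  \<open>x\<close>, evaluated at \<open>a\<close>, cancels all values of \<open>f\<close>: the two remainders sum to
  \<open>(f' x - f' a) * (x - a)\<close>. Both are bounded by \<open>K * (x - a)\<^sup>2\<close>, and dividing by \<open>\<bar>x - a\<bar>\<close> gives the
  Lipschitz constant \<open>2 * K\<close>.\<close>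

theorem mainTheorem2:
  fixes I :: "real set" and f f' :: "real \<Rightarrow> real"
  assumes "is_interval I" and "ULD_on I f f'"
  shows "\<exists>L. L-lipschitz_on I f'"
proof -
  obtain K where K: "\<And>x a. x \<in> I \<Longrightarrow> a \<in> I \<Longrightarrow> \<bar>f x - f a - f' a * (x - a)\<bar> \<le> K * (x - a)\<^sup>2"
    using assms(2) unfolding ULD_on_def by blast
  \<comment> \<open>If \<open>I\<close> has at most one point, \<open>K\<close> may be negative, whereas a Lipschitz constant may not.\<close>
  have "(2 * \<bar>K\<bar>)-lipschitz_on I f'"
  proof (rule lipschitz_onI)
    fix x a assume "x \<in> I" "a \<in> I"
    have "(f' x - f' a) * (x - a) =
        (f x - f a - f' a * (x - a)) + (f a - f x - f' x * (a - x))"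
      by (simp add: algebra_simps)
    also have "\<bar>\<dots>\<bar> \<le> K * (x - a)\<^sup>2 + K * (a - x)\<^sup>2"
      using K[OF \<open>x \<in> I\<close> \<open>a \<in> I\<close>] K[OF \<open>a \<in> I\<close> \<open>x \<in> I\<close>] by linarith
    also have "\<dots> = 2 * K * (x - a)\<^sup>2"
      by (simp add: power2_commute[of a x])
    also have "\<dots> \<le> 2 * \<bar>K\<bar> * (x - a)\<^sup>2"
      by (intro mult_right_mono) auto
    also have "\<dots> = 2 * \<bar>K\<bar> * \<bar>x - a\<bar> * \<bar>x - a\<bar>"
      by (simp add: power2_eq_square mult.assoc)
    finally have "\<bar>f' x - f' a\<bar> * \<bar>x - a\<bar> \<le> 2 * \<bar>K\<bar> * \<bar>x - a\<bar> * \<bar>x - a\<bar>"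
      by (simp add: abs_mult)
    then have "\<bar>f' x - f' a\<bar> \<le> 2 * \<bar>K\<bar> * \<bar>x - a\<bar>"
      by (cases "x = a") auto
    then show "dist (f' x) (f' a) \<le> 2 * \<bar>K\<bar> * dist x a"
      by (simp add: dist_real_def)
  qed simp
  then show ?thesis by blast
qed

end
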